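(* Let $\mathfrak{g}=\mathfrak{g}_L\ltimes\mathfrak{h}$ be a perfect Lie algebra with simple Levi subalgebra $\mathfrak{g}_L$ and $\mathfrak{h}=\mathrm{Rad}(\mathfrak{g})$. If $\mathfrak{h}$ decomposes, as a $\mathfrak{g}_L$-module, into a direct sum of exactly one or exactly two simple $\mathfrak{g}_L$-modules, then $\mathfrak{g}$ is not sympathetic.
   Context: All Lie algebras and vector spaces are finite dimensional over $\mathbb{C}$. $\mathfrak{g}$ is perfect if $\mathfrak{g}=[\mathfrak{g},\mathfrak{g}]$, and sympathetic if $Z(\mathfrak{g})=0$, $\mathfrak{g}=[\mathfrak{g},\mathfrak{g}]$ and $\mathrm{Der}(\mathfrak{g})=\mathrm{ad}(\mathfrak{g})$. $\mathfrak{g}=\mathfrak{g}_L\ltimes\mathfrak{h}$ is a Levi decomposition, and $\mathfrak{h}$ is a $\mathfrak{g}_L$-module via the Lie bracket. *)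

theory Defs
  imports Complex_Main
begin

text \<open>
  The underlying vector space of the Lie algebra is the whole type \<open>'a\<close>; subalgebras, ideals and
  modules are subsets of it.
\<close>

locale lie_algebra = vector_space scale
  for scale :: "complex \<Rightarrow> 'a::ab_group_add \<Rightarrow> 'a" +
  fixes bracket :: "'a \<Rightarrow> 'a \<Rightarrow> 'a"
  assumes finite_dimensional: "\<exists>B. finite B \<and> span B = UNIV"
    and bracket_add_left: "bracket (x + y) z = bracket x z + bracket y z"
    and bracket_add_right: "bracket x (y + z) = bracket x y + bracket x z"
    and bracket_scale_left: "bracket (scale c x) y = scale c (bracket x y)"
    and bracket_scale_right: "bracket x (scale c y) = scale c (bracket x y)"
    and bracket_self: "bracket x x = 0"
    and jacobi: "bracket x (bracket y z) + bracket y (bracket z x) + bracket z (bracket x y) = 0"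
begin

definition bracket_space :: "'a set \<Rightarrow> 'a set \<Rightarrow> 'a set" where
  "bracket_space A B = span {bracket a b | a b. a \<in> A \<and> b \<in> B}"

definition subalgebra :: "'a set \<Rightarrow> bool" where
  "subalgebra K \<longleftrightarrow> subspace K \<and> (\<forall>x\<in>K. \<forall>y\<in>K. bracket x y \<in> K)"

text \<open>\<open>lie_ideal K I\<close>: \<open>I\<close> is an ideal of the subalgebra \<open>K\<close>.\<close>

definition lie_ideal :: "'a set \<Rightarrow> 'a set \<Rightarrow> bool" where
  "lie_ideal K I \<longleftrightarrow> subspace I \<and> I \<subseteq> K \<and> (\<forall>x\<in>K. \<forall>y\<in>I. bracket x y \<in> I)"

primrec derived_series :: "'a set \<Rightarrow> nat \<Rightarrow> 'a set" where
  "derived_series K 0 = K"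
| "derived_series K (Suc n) = bracket_space (derived_series K n) (derived_series K n)"

definition solvable :: "'a set \<Rightarrow> bool" where
  "solvable K \<longleftrightarrow> (\<exists>n. derived_series K n = {0})"

text \<open>\<open>is_radical K R\<close>: \<open>R\<close> is the radical of \<open>K\<close>, i.e. its (unique) largest solvable ideal.\<close>

definition is_radical :: "'a set \<Rightarrow> 'a set \<Rightarrow> bool" where
  "is_radical K R \<longleftrightarrow> lie_ideal K R \<and> solvable R \<and>
     (\<forall>I. lie_ideal K I \<and> solvable I \<longrightarrow> I \<subseteq> R)"

definition semisimple_lie :: "'a set \<Rightarrow> bool" where
  "semisimple_lie K \<longleftrightarrow> subalgebra K \<and> is_radical K {0}"

definition simple_lie :: "'a set \<Rightarrow> bool" where
  "simple_lie K \<longleftrightarrow> subalgebra K \<and> bracket_space K K \<noteq> {0} \<and>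
     (\<forall>I. lie_ideal K I \<longrightarrow> I = {0} \<or> I = K)"

definition direct_sum :: "'a set \<Rightarrow> 'a set \<Rightarrow> 'a set \<Rightarrow> bool" where
  "direct_sum U V W \<longleftrightarrow> subspace V \<and> subspace W \<and> U = {v + w | v w. v \<in> V \<and> w \<in> W} \<and> V \<inter> W = {0}"

definition levi_decomposition :: "'a set \<Rightarrow> 'a set \<Rightarrow> bool" where
  "levi_decomposition L H \<longleftrightarrow>
     semisimple_lie L \<and> is_radical UNIV H \<and> direct_sum UNIV L H"

text \<open>Modules over a subalgebra \<open>L\<close> are taken with respect to the action given by the bracket.\<close>

definition lie_submodule :: "'a set \<Rightarrow> 'a set \<Rightarrow> bool" where
  "lie_submodule L M \<longleftrightarrow> subspace M \<and> (\<forall>x\<in>L. \<forall>m\<in>M. bracket x m \<in> M)"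

definition simple_module :: "'a set \<Rightarrow> 'a set \<Rightarrow> bool" where
  "simple_module L M \<longleftrightarrow> lie_submodule L M \<and> M \<noteq> {0} \<and>
     (\<forall>N. lie_submodule L N \<and> N \<subseteq> M \<longrightarrow> N = {0} \<or> N = M)"

definition perfect :: bool where
  "perfect \<longleftrightarrow> bracket_space UNIV UNIV = UNIV"

definition center :: "'a set" where
  "center = {z. \<forall>x. bracket z x = 0}"

definition Der :: "('a \<Rightarrow> 'a) set" where
  "Der = {D. Vector_Spaces.linear scale scale D \<and> (\<forall>x y. D (bracket x y) = bracket (D x) y + bracket x (D y))}"

definition ad :: "'a \<Rightarrow> 'a \<Rightarrow> 'a" where
  "ad x = (\<lambda>y. bracket x y)"

definition sympathetic :: bool where
  "sympathetic \<longleftrightarrow> center = {0} \<and> perfect \<and> Der = range ad"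

end

end

theory Submission
  imports Defs "HOL-Computational_Algebra.Fundamental_Theorem_Algebra"
begin

text \<open>
  The derived algebra \<open>C = [H, H]\<close> is a proper \<open>L\<close>-submodule of the solvable ideal \<open>H\<close>, hence it is
  zero (then let \<open>U = H\<close>), or simple with a module complement \<open>U\<close> in \<open>H\<close>. In the second case \<open>C\<close> is abelian, so \<open>U\<close>
  acts on \<open>C\<close> by commuting operators and has a common eigenvector there. As in Lie's theorem, the
  eigenvalues of elements of \<open>[L, U]\<close>, which is \<open>U\<close> because the algebra is perfect, vanish, and
  simplicity of \<open>C\<close> gives \<open>[U, C] = 0\<close>. The map that is \<open>0\<close> on \<open>L\<close>, the identity on \<open>U\<close> and twice the
  identity on \<open>C\<close> is then a derivation. It is not inner: it kills \<open>L\<close>, so it could only be the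
  adjoint action of an element of \<open>H\<close>, but these map \<open>U\<close> into \<open>C\<close>.
\<close>

section \<open>Polynomials in an operator applied to a vector\<close>

text \<open>The vector \<open>p(T) v\<close>. Scalar multiplication is the argument
  \<open>s\<close>, as the vector space structure is a locale parameter.\<close>

definition poly_apply :: "('a::zero \<Rightarrow> 'b \<Rightarrow> 'b::comm_monoid_add) \<Rightarrow> 'a poly \<Rightarrow> ('b \<Rightarrow> 'b) \<Rightarrow> 'b \<Rightarrow> 'b" where
  "poly_apply s p T v = (\<Sum>i\<le>degree p. s (coeff p i) ((T ^^ i) v))"

context vector_space
begin

text \<open>If every term were new, the first \<open>k\<close> terms would be \<open>k\<close>
  independent vectors, exceeding the bound \<open>card B\<close> for large \<open>k\<close>.\<close>

lemma sequence_dependent: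
  assumes "finite B" "span B = UNIV"
  shows "\<exists>k::nat. f k \<in> span (f ` {..<k})"
proof (rule ccontr)
  assume "\<nexists>k. f k \<in> span (f ` {..<k})"
  then have new: "f k \<notin> span (f ` {..<k})" for k by blast
  have "independent (f ` {..<k}) \<and> card (f ` {..<k}) = k" for k
  proof (induction k)
    case (Suc k)
    have "f k \<notin> f ` {..<k}" using new[of k] span_base[of "f k" "f ` {..<k}"] by blast
    then show ?case using Suc new[of k]
      by (simp add: lessThan_Suc independent_insertI)
  qed (simp add: independent_empty)
  then have "k \<le> card B" for k
    using independent_span_bound[OF assms(1), of "f ` {..<k}"] assms(2) by auto
  then show False using not_less_eq_eq by blast
qed

text \<open>Coefficients above the degree vanish, so polynomials of different degrees can be
  compared over one summation range.\<close>

lemma poly_apply_altdef: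
  assumes "degree p \<le> n"
  shows "poly_apply scale p T v = (\<Sum>i\<le>n. scale (coeff p i) ((T ^^ i) v))"
  unfolding poly_apply_def using assms
  by (intro sum.mono_neutral_left) (auto simp: not_le coeff_eq_0)

lemma poly_apply_add: "poly_apply scale (p + q) T v = poly_apply scale p T v + poly_apply scale q T v"
proof -
  let ?n = "max (degree p) (degree q)"
  have "degree (p + q) \<le> ?n" by (rule degree_add_le_max)
  then show ?thesis
    by (simp add: poly_apply_altdef[where n = ?n] scale_left_distrib sum.distrib)
qed

lemma poly_apply_smult: "poly_apply scale (smult a p) T v = scale a (poly_apply scale p T v)"
  using degree_smult_le[of a p]
  by (simp add: poly_apply_altdef[where n = "degree p"] scale_sum_right)

lemma poly_apply_pCons_0:
  assumes "Vector_Spaces.linear scale scale T"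
  shows "poly_apply scale (pCons 0 p) T v = T (poly_apply scale p T v)"
proof -
  interpret T: Vector_Spaces.linear scale scale T by fact
  have "poly_apply scale (pCons 0 p) T v =
      (\<Sum>i\<le>Suc (degree p). scale (coeff (pCons 0 p) i) ((T ^^ i) v))"
    by (rule poly_apply_altdef) (rule degree_pCons_le)
  also have "\<dots> = (\<Sum>i\<le>degree p. scale (coeff p i) (T ((T ^^ i) v)))"
    by (subst sum.atMost_Suc_shift) simp
  also have "\<dots> = T (poly_apply scale p T v)"
    by (simp add: poly_apply_def T.sum T.scale)
  finally show ?thesis .
qed

text \<open>If the left side vanishes, \<open>q(T) v\<close> satisfies the eigenvector equation for
  \<open>a\<close>; this turns roots into eigenvalues.\<close>

lemma poly_apply_linear_factor:
  assumes "Vector_Spaces.linear scale scale T"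
  shows "poly_apply scale ([:- a, 1:] * q) T v = T (poly_apply scale q T v) - scale a (poly_apply scale q T v)"
proof -
  have "[:- a, 1:] * q = smult (- a) q + pCons 0 q" by simp
  then show ?thesis
    by (simp only: poly_apply_add poly_apply_smult poly_apply_pCons_0[OF assms]) simp
qed

lemma poly_apply_monom: "poly_apply scale (monom c i) T v = scale c ((T ^^ i) v)"
proof -
  have "(\<Sum>j\<le>i. scale (coeff (monom c i) j) ((T ^^ j) v)) =
      (\<Sum>j\<in>{i}. scale (coeff (monom c i) j) ((T ^^ j) v))"
    by (rule sum.mono_neutral_right) auto
  then show ?thesis by (simp add: poly_apply_altdef[OF degree_monom_le])
qed

lemma poly_apply_in_subspace:
  assumes "subspace K" "\<And>y. y \<in> K \<Longrightarrow> T y \<in> K" "v \<in> K"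
  shows "poly_apply scale p T v \<in> K"
proof -
  have "(T ^^ i) v \<in> K" for i by (induction i) (auto intro: assms)
  then show ?thesis unfolding poly_apply_def
    by (intro subspace_sum subspace_scale assms)
qed

text \<open>Some iterate \<open>T^k v\<close> is a combination of the earlier ones; moving
  everything to one side gives the polynomial.\<close>

lemma ex_annihilating_poly:
  assumes "finite B" "span B = UNIV"
  shows "\<exists>p. p \<noteq> 0 \<and> poly_apply scale p T v = 0"
proof -
  let ?f = "\<lambda>i. (T ^^ i) v"
  obtain k where k: "?f k \<in> span (?f ` {..<k})"
    using sequence_dependent[OF assms, of ?f] by (elim exE)
  \<comment> \<open>The degree bound is kept because it later guarantees that the annihilating
    polynomial is nonzero.\<close>
  have comb: "\<exists>p. degree p \<le> m \<and> poly_apply scale p T v = y" if "y \<in> span (?f ` {..m})" for m y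
    using that
  proof (induction rule: span_induct_alt)
    case base
    show ?case by (rule exI[of _ 0]) (simp add: poly_apply_def)
  next
    case (step c x y)
    then obtain i p where "i \<le> m" "x = ?f i" and p: "degree p \<le> m" "poly_apply scale p T v = y"
      by auto
    moreover have "poly_apply scale (monom c i) T v = scale c (?f i)" by (rule poly_apply_monom)
    moreover have "degree (monom c i + p) \<le> m"
      using \<open>i \<le> m\<close> p degree_monom_le[of c i] by (intro degree_add_le) auto
    ultimately show ?case by (metis poly_apply_add)
  qed
  have top: "poly_apply scale (monom 1 k) T v = ?f k"
    by (simp add: poly_apply_monom)
  show ?thesis
  proof (cases k)
    \<comment> \<open>Here \<open>v\<close> lies in the span of the empty set, so
      \<open>v = 0\<close> and the constant polynomial 1 annihilates it.\<close>
    case 0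
    then have "poly_apply scale 1 T v = 0" using k by (simp add: poly_apply_def)
    then show ?thesis by (intro exI[of _ 1]) simp
  next
    case (Suc m)
    then have "?f k \<in> span (?f ` {..m})" using k by (simp add: lessThan_Suc_atMost)
    from comb[OF this] obtain p where p: "degree p \<le> m" "poly_apply scale p T v = ?f k" by blast
    \<comment> \<open>Since \<open>degree p < k\<close>, the coefficient of \<open>?q\<close> at
      \<open>k\<close> is 1.\<close>
    let ?q = "monom 1 k + smult (-1) p"
    have "poly_apply scale ?q T v = 0" by (simp add: poly_apply_add top poly_apply_smult p del: smult_minus_left)
    moreover have "coeff ?q k = 1" using p Suc by (simp add: coeff_eq_0)
    then have "?q \<noteq> 0" by force
    ultimately show ?thesis by blast
  qed
qed

end

section \<open>Eigenvectors inside an invariant subspace\<close>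

context lie_algebra
begin

text \<open>Split a root \<open>a\<close> off an annihilating polynomial,
  \<open>p = (X - a) q\<close>. Either \<open>q(T) v\<close> is nonzero and an eigenvector for
  \<open>a\<close>, or \<open>q\<close> annihilates \<open>v\<close> and has smaller degree. A
  nonzero constant cannot annihilate \<open>v\<close>, so the descent stops at an
  eigenvector.\<close>

lemma ex_eigenvector:
  assumes T: "Vector_Spaces.linear scale scale T"
    and K: "subspace K" "\<And>y. y \<in> K \<Longrightarrow> T y \<in> K" and "v \<in> K" "v \<noteq> 0"
  shows "\<exists>a. \<exists>w\<in>K. w \<noteq> 0 \<and> T w = scale a w"
proof -
  obtain p where "p \<noteq> 0" "poly_apply scale p T v = 0"
    using finite_dimensional ex_annihilating_poly by blast
  then show ?thesis
  proof (induction "degree p" arbitrary: p)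
    case 0
    then obtain c where "p = [:c:]" "c \<noteq> 0" by (metis degree_eq_zeroE pCons_0_0)
    then show ?case using 0 \<open>v \<noteq> 0\<close> by (simp add: poly_apply_def)
  next
    case (Suc n)
    then have "\<not> constant (poly p)" by (simp add: constant_degree)
    then obtain a where "poly p a = 0" using fundamental_theorem_of_algebra by blast
    then obtain q where q: "p = [:- a, 1:] * q" unfolding poly_eq_0_iff_dvd by blast
    then have "q \<noteq> 0" using Suc by auto
    then have "degree p = Suc (degree q)" unfolding q by (subst degree_mult_eq) auto
    then have "degree q = n" using Suc by simp
    show ?case
    proof (cases "poly_apply scale q T v = 0")
      case True
      then show ?thesis using Suc.hyps(1)[of q] \<open>degree q = n\<close> \<open>q \<noteq> 0\<close> by blast
    next
      case False
      have "T (poly_apply scale q T v) = scale a (poly_apply scale q T v)"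
        using Suc.prems(2) poly_apply_linear_factor[OF T, of a q v] q by simp
      moreover have "poly_apply scale q T v \<in> K"
        by (rule poly_apply_in_subspace[OF K \<open>v \<in> K\<close>])
      ultimately show ?thesis using False by blast
    qed
  qed
qed

section \<open>Bracket identities, spans of brackets and solvability\<close>

lemma linear_bracket: "Vector_Spaces.linear scale scale (bracket x)"
  by unfold_locales (auto simp: bracket_add_right bracket_scale_right)

lemma bracket_zero_right [simp]: "bracket x 0 = 0"
  using bracket_scale_right[of x 0 0] by simp

lemma bracket_zero_left [simp]: "bracket 0 x = 0"
  using bracket_scale_left[of 0 0 x] by simp

lemma bracket_minus_right: "bracket x (- y) = - bracket x y"
  using bracket_scale_right[of x "-1" y] by simp

lemma bracket_diff_right: "bracket x (y - z) = bracket x y - bracket x z"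
  using bracket_add_right[of x y "- z"] by (simp add: bracket_minus_right)

lemma bracket_antisym: "bracket y x = - bracket x y"
proof -
  have "bracket (x + y) (x + y) = 0" by (rule bracket_self)
  then have "bracket y x + bracket x y = 0"
    unfolding bracket_add_left bracket_add_right by (simp add: bracket_self add.commute)
  then show ?thesis by (simp add: eq_neg_iff_add_eq_0)
qed

text \<open>The Jacobi identity in Leibniz form, the form in which all later proofs use it.\<close>

lemma bracket_derivation:
  "bracket x (bracket y z) = bracket (bracket x y) z + bracket y (bracket x z)"
proof -
  have "bracket y (bracket z x) = - bracket y (bracket x z)"
    by (simp add: bracket_antisym[of z x] bracket_minus_right)
  moreover have "bracket z (bracket x y) = - bracket (bracket x y) z"
    by (rule bracket_antisym)
  ultimately show ?thesis using jacobi[of x y z] by (simp add: algebra_simps)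
qed

lemma subspace_bracket_space: "subspace (bracket_space A B)"
  by (simp add: bracket_space_def)

lemma bracket_in_bracket_space: "\<lbrakk>a \<in> A; b \<in> B\<rbrakk> \<Longrightarrow> bracket a b \<in> bracket_space A B"
  unfolding bracket_space_def by (rule span_base) blast

lemma bracket_space_subset:
  assumes "subspace S" "\<And>a b. \<lbrakk>a \<in> A; b \<in> B\<rbrakk> \<Longrightarrow> bracket a b \<in> S"
  shows "bracket_space A B \<subseteq> S"
  unfolding bracket_space_def by (rule span_minimal) (use assms in auto)

lemma bracket_space_mono: "\<lbrakk>A \<subseteq> A'; B \<subseteq> B'\<rbrakk> \<Longrightarrow> bracket_space A B \<subseteq> bracket_space A' B'"
  by (rule bracket_space_subset) (auto intro: subspace_bracket_space bracket_in_bracket_space)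

text \<open>By the Leibniz rule \<open>bracket x\<close> sends each generator to a sum of two
  generators.\<close>

lemma lie_submodule_bracket_space:
  assumes "lie_submodule L A" "lie_submodule L B"
  shows "lie_submodule L (bracket_space A B)"
  unfolding lie_submodule_def
proof (intro conjI ballI subspace_bracket_space)
  fix x m assume "x \<in> L" "m \<in> bracket_space A B"
  have "bracket_space A B \<subseteq> {m. bracket x m \<in> bracket_space A B}"
  proof (rule bracket_space_subset)
    show "subspace {m. bracket x m \<in> bracket_space A B}"
      using subspace_bracket_space[of A B]
      by (auto simp: subspace_def bracket_add_right bracket_scale_right)
    fix a b assume "a \<in> A" "b \<in> B"
    then show "bracket a b \<in> {m. bracket x m \<in> bracket_space A B}"
      using assms \<open>x \<in> L\<close>
      by (auto simp: bracket_derivation[of x] lie_submodule_def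
          intro!: subspace_add subspace_bracket_space bracket_in_bracket_space)
  qed
  then show "bracket x m \<in> bracket_space A B" using \<open>m \<in> bracket_space A B\<close> by blast
qed

text \<open>A set equal to its own bracket space stays inside every term of the derived series. Used
  to show that \<open>[H, H]\<close> is smaller than \<open>H\<close>, and \<open>[C, C]\<close>
  smaller than \<open>C\<close>.\<close>

lemma solvable_perfect_subset_trivial:
  assumes "solvable K" "A \<subseteq> K" "bracket_space A A = A"
  shows "A = {0}"
proof -
  have "A \<subseteq> derived_series K n" for n
  proof (induction n)
    case (Suc n)
    then have "bracket_space A A \<subseteq> derived_series K (Suc n)" by (simp add: bracket_space_mono)
    then show ?case by (simp only: assms(3))
  qed (simp add: assms(2))
  moreover have "0 \<in> A" using subspace_0[OF subspace_bracket_space[of A A]] by (simp only: assms(3))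
  ultimately show ?thesis using assms(1) unfolding solvable_def by blast
qed

section \<open>Submodules of a direct sum of two simple modules\<close>

lemma lie_submodule_Int:
  "\<lbrakk>lie_submodule L A; lie_submodule L B\<rbrakk> \<Longrightarrow> lie_submodule L (A \<inter> B)"
  by (auto simp: lie_submodule_def subspace_inter)

lemma lie_submodule_sum:
  assumes "lie_submodule L A" "lie_submodule L B"
  shows "lie_submodule L {a + b | a b. a \<in> A \<and> b \<in> B}"
  unfolding lie_submodule_def
proof (intro conjI ballI)
  show "subspace {a + b | a b. a \<in> A \<and> b \<in> B}"
    using assms by (intro subspace_sums) (auto simp: lie_submodule_def)
  fix x m assume "x \<in> L" "m \<in> {a + b | a b. a \<in> A \<and> b \<in> B}"
  then show "bracket x m \<in> {a + b | a b. a \<in> A \<and> b \<in> B}"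
    using assms by (force simp: lie_submodule_def bracket_add_right)
qed

lemma direct_sum_commute: "direct_sum H V W \<Longrightarrow> direct_sum H W V"
proof -
  have "{v + w | v w. v \<in> V \<and> w \<in> W} = {w + v | w v. w \<in> W \<and> v \<in> V}"
    using add.commute[where 'a = 'a] by blast
  then show "direct_sum H V W \<Longrightarrow> direct_sum H W V"
    unfolding direct_sum_def by (simp add: Int_commute)
qed

text \<open>A nonzero element of \<open>N\<close> has a nonzero component \<open>w\<close> in
  \<open>W\<close>, because \<open>N\<close> meets \<open>V\<close> trivially. So
  \<open>N + V\<close> meets the simple module \<open>W\<close> in a nonzero submodule, hence
  contains \<open>W\<close> and is all of \<open>H\<close>.\<close>

lemma complement_of_submodule:
  assumes "lie_submodule L V" "simple_module L W" "direct_sum H V W"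
    and N: "lie_submodule L N" "N \<subseteq> H" "N \<noteq> {0}" "N \<inter> V = {0}"
  shows "direct_sum H N V"
proof -
  let ?S = "{n + v | n v. n \<in> N \<and> v \<in> V}"
  have sub: "subspace V" "subspace W" "subspace N" "subspace ?S"
    and VW: "H = {v + w | v w. v \<in> V \<and> w \<in> W}" "V \<inter> W = {0}"
    using assms lie_submodule_sum[OF N(1) assms(1)]
    by (auto simp: direct_sum_def lie_submodule_def)
  obtain n where n: "n \<in> N" "n \<noteq> 0" using N(3) sub(3) subspace_0 by blast
  then obtain v w where vw: "n = v + w" "v \<in> V" "w \<in> W" using N(2) VW(1) by blast
  have "w \<noteq> 0"
  proof
    assume "w = 0"
    then have "n \<in> N \<inter> V" using vw n by simp
    then show False using N(4) n by simp
  qed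
  moreover have "w = n + (- v)" using vw by simp
  then have "w \<in> ?S" using n(1) subspace_neg[OF sub(1) vw(2)] by blast
  moreover have "lie_submodule L (?S \<inter> W)"
    using assms lie_submodule_sum[OF N(1) assms(1)]
    by (intro lie_submodule_Int) (auto simp: simple_module_def)
  ultimately have "?S \<inter> W = W" using assms(2) vw(3) unfolding simple_module_def by blast
  then have "W \<subseteq> ?S" by blast
  moreover have "V \<subseteq> ?S" using subspace_0[OF sub(3)] by force
  ultimately have "H \<subseteq> ?S" unfolding VW(1) using subspace_add[OF sub(4)] by blast
  moreover have "V \<subseteq> H" using subspace_0[OF sub(2)] unfolding VW(1) by force
  moreover have "subspace H" unfolding VW(1) using sub by (intro subspace_sums)
  then have "?S \<subseteq> H" using N(2) \<open>V \<subseteq> H\<close> subspace_add by blast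
  ultimately have "H = ?S" by blast
  then show ?thesis using sub N(4) unfolding direct_sum_def by simp
qed

text \<open>A nonzero submodule \<open>N\<close> of \<open>M\<close> is itself a complement of
  \<open>V\<close>. The \<open>V\<close>-component of any \<open>m\<close> in \<open>M\<close> then
  lies in \<open>M \<inter> V\<close>, so it vanishes and \<open>m\<close> is in
  \<open>N\<close>.\<close>

lemma simple_of_complement:
  assumes "lie_submodule L V" "simple_module L W" "direct_sum H V W"
    and M: "lie_submodule L M" "M \<subseteq> H" "M \<noteq> {0}" "M \<inter> V = {0}"
  shows "simple_module L M"
  unfolding simple_module_def
proof (intro conjI allI impI M(1,3))
  fix N assume N: "lie_submodule L N \<and> N \<subseteq> M"
  have "0 \<in> N" "subspace M" "0 \<in> V" using N M(1) assms(1) subspace_0 by (auto simp: lie_submodule_def)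
  show "N = {0} \<or> N = M"
  proof (rule disjCI)
    assume "N \<noteq> M"
    show "N = {0}"
    proof (rule ccontr)
      assume "N \<noteq> {0}"
      moreover have "N \<inter> V = {0}" using N M(4) \<open>0 \<in> N\<close> \<open>0 \<in> V\<close> by blast
      ultimately have "direct_sum H N V"
        using complement_of_submodule[OF assms(1-3)] N M(2) by blast
      then have H: "H = {n + v | n v. n \<in> N \<and> v \<in> V}" by (simp add: direct_sum_def)
      have "m \<in> N" if m: "m \<in> M" for m
      proof -
        obtain n v where nv: "m = n + v" "n \<in> N" "v \<in> V" using m M(2) H by blast
        then have "v = m - n" by simp
        then have "v \<in> M" using subspace_diff[OF \<open>subspace M\<close>] m nv N by blast
        then have "v = 0" using nv M(4) by blast
        then show "m \<in> N" using nv by simp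
      qed
      then show False using \<open>N \<noteq> M\<close> N by blast
    qed
  qed
qed

text \<open>One of the two summands serves as complement: \<open>V\<close> if \<open>M\<close> meets
  it trivially. Otherwise \<open>M\<close> contains \<open>V\<close>, so being proper it cannot
  contain \<open>W\<close>, and \<open>W\<close> is the complement.\<close>

lemma proper_submodule_simple_with_complement:
  assumes V: "simple_module L V" and W: "simple_module L W" and dir: "direct_sum H V W"
    and M: "lie_submodule L M" "M \<subseteq> H" "M \<noteq> {0}" "M \<noteq> H"
  shows "simple_module L M \<and> (\<exists>U. simple_module L U \<and> direct_sum H M U)"
proof -
  have subm: "lie_submodule L V" "lie_submodule L W" using V W by (auto simp: simple_module_def)
  show ?thesis
  proof (cases "M \<inter> V = {0}")
    case True
    then show ?thesis
      using complement_of_submodule[OF subm(1) W dir M(1-3)]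
        simple_of_complement[OF subm(1) W dir M(1-3)] V by blast
  next
    case False
    have "M \<inter> V = V"
      using V False lie_submodule_Int[OF M(1) subm(1)] unfolding simple_module_def by blast
    have "M \<inter> W \<noteq> W"
    proof
      assume "M \<inter> W = W"
      then have "H \<subseteq> M" using \<open>M \<inter> V = V\<close> dir M(1)
        by (auto simp: direct_sum_def lie_submodule_def intro!: subspace_add)
      then show False using M by blast
    qed
    then have "M \<inter> W = {0}"
      using W lie_submodule_Int[OF M(1) subm(2)] unfolding simple_module_def by blast
    then show ?thesis
      using complement_of_submodule[OF subm(2) V direct_sum_commute[OF dir] M(1-3)]
        simple_of_complement[OF subm(2) V direct_sum_commute[OF dir] M(1-3)] W by blast
  qed
qed

section \<open>Common eigenvectors and Lie's theorem for the action of \<open>U\<close> on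
  \<open>C\<close>\<close>

text \<open>Operators are added one at a time: a joint eigenspace is preserved by every operator
  commuting with the earlier ones, so it contains an eigenvector of the next.\<close>

lemma ex_common_eigenvector:
  assumes "finite B" "subspace C" "C \<noteq> {0}"
    and inv: "\<And>u c. \<lbrakk>u \<in> B; c \<in> C\<rbrakk> \<Longrightarrow> bracket u c \<in> C"
    and comm: "\<And>u u' c. \<lbrakk>u \<in> B; u' \<in> B; c \<in> C\<rbrakk> \<Longrightarrow> bracket u (bracket u' c) = bracket u' (bracket u c)"
  shows "\<exists>c\<in>C. c \<noteq> 0 \<and> (\<forall>u\<in>B. \<exists>a. bracket u c = scale a c)"
proof -
  \<comment> \<open>The eigenvalues are collected in one function \<open>a\<close> so that the joint
    eigenspace \<open>?K\<close> can be formed in the induction step.\<close>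
  have "\<exists>a. \<exists>c\<in>C. c \<noteq> 0 \<and> (\<forall>u\<in>A. bracket u c = scale (a u) c)" if "A \<subseteq> B" for A
    using finite_subset[OF that assms(1)] that
  proof (induction A rule: finite_induct)
    case empty
    show ?case using assms(2,3) subspace_0 by auto
  next
    case (insert u A)
    then obtain a c where c: "c \<in> C" "c \<noteq> 0" "\<forall>u\<in>A. bracket u c = scale (a u) c" by blast
    let ?K = "{c \<in> C. \<forall>u\<in>A. bracket u c = scale (a u) c}"
    have K: "subspace ?K"
      using assms(2) by (auto simp: subspace_def bracket_add_right bracket_scale_right
          scale_right_distrib scale_left_commute)
    have "bracket u k \<in> ?K" if k: "k \<in> ?K" for k
    proof -
      have "bracket w (bracket u k) = scale (a w) (bracket u k)" if "w \<in> A" for w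
        using k insert.prems that comm[of w u k] by (auto simp: bracket_scale_right)
      then show ?thesis using k insert.prems inv by auto
    qed
    then obtain b k where k: "k \<in> ?K" "k \<noteq> 0" "bracket u k = scale b k"
      using ex_eigenvector[OF linear_bracket K, of u c] c by blast
    have "\<forall>w\<in>insert u A. bracket w k = scale ((a(u := b)) w) k"
      using k insert.hyps by auto
    then show ?case using k by blast
  qed
  from this[OF order_refl] show ?thesis by blast
qed

text \<open>
  The key step of Lie's theorem without traces: modulo lower powers, \<open>ad u - \<phi> u\<close> sends
  \<open>(ad x)\<^sup>k c\<close> to \<open>- k \<phi>[x, u] (ad x)\<^sup>k\<^sup>-\<^sup>1 c\<close>, so if \<open>\<phi>[x, u] \<noteq> 0\<close> then all these vectors would be
  independent.
\<close>

lemma eigenvalue_of_bracket_zero: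
  assumes U: "\<And>w. w \<in> U \<Longrightarrow> bracket x w \<in> U"
    and eig: "\<And>w. w \<in> U \<Longrightarrow> bracket w c = scale (\<phi> w) c"
    and "c \<noteq> 0" "u \<in> U"
  shows "bracket (bracket x u) c = 0"
proof (rule ccontr)
  assume "bracket (bracket x u) c \<noteq> 0"
  then have \<mu>: "\<phi> (bracket x u) \<noteq> 0"
    unfolding eig[OF U[OF \<open>u \<in> U\<close>]] by (metis scale_zero_left)
  define f where "f k = (bracket x ^^ k) c" for k
  \<comment> \<open>\<open>F k\<close> stops before \<open>f k\<close>, so \<open>F 0 = {0}\<close>
    and independence means that \<open>f k\<close> is never in \<open>F k\<close>.\<close>
  define F where "F k = span (f ` {..<k})" for k
  have f_Suc: "f (Suc k) = bracket x (f k)" for k by (simp add: f_def)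
  have F_sub: "subspace (F k)" for k by (simp add: F_def)
  have F_mono: "F j \<subseteq> F k" if "j \<le> k" for j k
    unfolding F_def using that by (intro span_mono) auto
  have f_in: "f j \<in> F k" if "j < k" for j k
    unfolding F_def using that by (intro span_base) auto
  have x_F: "bracket x y \<in> F (Suc k)" if "y \<in> F k" for y k
  proof -
    have "F k \<subseteq> {y. bracket x y \<in> F (Suc k)}" unfolding F_def[of k]
    proof (rule span_minimal)
      show "subspace {y. bracket x y \<in> F (Suc k)}"
        using F_sub[of "Suc k"] by (auto simp: subspace_def bracket_add_right bracket_scale_right)
    qed (auto simp: f_Suc[symmetric] intro: f_in)
    then show ?thesis using that by blast
  qed
  \<comment> \<open>The claim is for all \<open>w\<close> in \<open>U\<close>, since the induction
    step also needs it for \<open>bracket x w\<close>. At \<open>k = 0\<close> the truncated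
    \<open>k - 1\<close> is harmless: the last coefficient is 0 and \<open>F 0 = {0}\<close>,
    leaving the eigenvector equation for \<open>c\<close>.\<close>
  have lower: "bracket w (f k) - scale (\<phi> w) (f k)
      + scale (of_nat k * \<phi> (bracket x w)) (f (k - 1)) \<in> F (k - 1)" if "w \<in> U" for w k
    using that
  proof (induction k arbitrary: w)
    case 0
    then show ?case by (simp add: f_def eig F_sub subspace_0)
  next
    case (Suc k)
    define y where "y = bracket w (f k) - scale (\<phi> w) (f k)
      + scale (of_nat k * \<phi> (bracket x w)) (f (k - 1))"
    define z where "z = bracket (bracket x w) (f k) - scale (\<phi> (bracket x w)) (f k)"
    have "y \<in> F (k - 1)" unfolding y_def by (rule Suc.IH[OF Suc.prems])
    \<comment> \<open>At \<open>k = 0\<close> the general bound would only give \<open>F 1\<close>,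
      but there \<open>y = 0\<close>.\<close>
    have xy: "bracket x y \<in> F k"
    proof (cases k)
      case 0
      then have "y = 0" using \<open>y \<in> F (k - 1)\<close> by (simp add: F_def)
      then show ?thesis by (simp add: F_sub subspace_0)
    qed (use x_F \<open>y \<in> F (k - 1)\<close> in fastforce)
    have z: "z \<in> F k"
    proof (cases k)
      case 0
      then show ?thesis using U[OF Suc.prems] by (simp add: z_def f_def eig F_sub subspace_0)
    next
      case (Suc m)
      let ?s = "scale (of_nat k * \<phi> (bracket x (bracket x w))) (f (k - 1))"
      have "z + ?s \<in> F (k - 1)"
        unfolding z_def by (rule Suc.IH) (rule U[OF Suc.prems])
      then have "z + ?s \<in> F k" using F_mono[of "k - 1" k] by auto
      moreover have "?s \<in> F k" using Suc f_in by (intro subspace_scale F_sub) auto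
      ultimately have "(z + ?s) - ?s \<in> F k" by (rule subspace_diff[OF F_sub])
      then show ?thesis by simp
    qed
    have top: "bracket x (scale (of_nat k * r) (f (k - 1))) = scale (of_nat k * r) (f k)" for r
      by (cases k) (auto simp: f_Suc bracket_scale_right)
    \<comment> \<open>Moving \<open>w\<close> past \<open>x\<close> costs
      \<open>bracket (bracket x w) (f k)\<close>, which contributes one further copy of
      \<open>\<phi> (bracket x w)\<close> and raises the factor from \<open>k\<close> to
      \<open>k + 1\<close>.\<close>
    have "bracket w (f (Suc k)) = bracket x (bracket w (f k)) - bracket (bracket x w) (f k)"
      unfolding f_Suc by (simp add: bracket_derivation[of x w])
    then have "bracket w (f (Suc k)) - scale (\<phi> w) (f (Suc k))
        + scale (of_nat (Suc k) * \<phi> (bracket x w)) (f k) = bracket x y - z"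
      unfolding y_def z_def bracket_add_right bracket_diff_right top
      by (simp add: f_Suc bracket_scale_right scale_left_distrib distrib_right)
    then show ?case using subspace_diff[OF F_sub xy z] by simp
  qed
  \<comment> \<open>This operator lowers the filtration \<open>F\<close> by one step.\<close>
  define A where "A y = bracket u y - scale (\<phi> u) y" for y
  have A_F: "A y \<in> F (k - 1)" if "y \<in> F k" for y k
  proof -
    have "F k \<subseteq> {y. A y \<in> F (k - 1)}" unfolding F_def[of k]
    proof (rule span_minimal)
      have "A (y + z) = A y + A z" "A (scale r y) = scale r (A y)" "A 0 = 0" for y z r
        by (simp_all add: A_def bracket_add_right bracket_scale_right scale_right_distrib
            scale_right_diff_distrib scale_left_commute)
      then show "subspace {y. A y \<in> F (k - 1)}"
        using F_sub[of "k - 1"] by (auto simp: subspace_def)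
      have "A (f j) \<in> F (k - 1)" if "j < k" for j
      proof -
        let ?s = "scale (of_nat j * \<phi> (bracket x u)) (f (j - 1))"
        have "A (f j) + ?s \<in> F (k - 1)"
          unfolding A_def using lower[OF \<open>u \<in> U\<close>, of j] F_mono[OF diff_le_mono[of j k 1]] that
          by (meson less_imp_le subsetD)
        \<comment> \<open>For \<open>j = 0\<close> the coefficient is 0; otherwise
          \<open>j < k\<close> gives \<open>j - 1 < k - 1\<close>.\<close>
        moreover have "?s \<in> F (k - 1)"
        proof (cases j)
          case (Suc i)
          then show ?thesis using that f_in[of i "k - 1"] F_sub by (auto intro: subspace_scale)
        qed (simp add: F_sub subspace_0)
        ultimately have "(A (f j) + ?s) - ?s \<in> F (k - 1)" by (rule subspace_diff[OF F_sub])
        then show ?thesis by simp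
      qed
      then show "f ` {..<k} \<subseteq> {y. A y \<in> F (k - 1)}" by auto
    qed
    then show ?thesis using that by blast
  qed
  \<comment> \<open>If \<open>f (Suc k)\<close> were in \<open>F (Suc k)\<close>, applying
    \<open>A\<close> would put a nonzero multiple of \<open>f k\<close> into \<open>F k\<close>. The
    multiple is nonzero in characteristic 0.\<close>
  have "f k \<notin> F k" for k
  proof (induction k)
    case 0
    show ?case using \<open>c \<noteq> 0\<close> by (simp add: f_def F_def)
  next
    case (Suc k)
    let ?r = "of_nat (Suc k) * \<phi> (bracket x u)"
    show ?case
    proof
      assume "f (Suc k) \<in> F (Suc k)"
      then have "A (f (Suc k)) \<in> F k" using A_F by fastforce
      moreover have "A (f (Suc k)) + scale ?r (f k) \<in> F k"
        using lower[OF \<open>u \<in> U\<close>, of "Suc k"] by (simp add: A_def)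
      ultimately have "(A (f (Suc k)) + scale ?r (f k)) - A (f (Suc k)) \<in> F k"
        by (metis subspace_diff[OF F_sub])
      then have "scale ?r (f k) \<in> F k" by simp
      then have "scale (1 / ?r) (scale ?r (f k)) \<in> F k" by (rule subspace_scale[OF F_sub])
      moreover have "?r \<noteq> 0" using \<mu> of_nat_neq_0 by simp
      ultimately show False using Suc by simp
    qed
  qed
  then show False
    using finite_dimensional sequence_dependent[of _ f] unfolding F_def by blast
qed

text \<open>A common eigenvector in \<open>C\<close> is killed by \<open>[L, U]\<close>, hence by
  \<open>U\<close>. The vectors of \<open>C\<close> killed by \<open>U\<close> form an
  \<open>L\<close>-submodule, so simplicity makes it all of \<open>C\<close>.\<close>

lemma commuting_module_acts_trivially:
  assumes C: "simple_module L C" and U: "lie_submodule L U" "U \<subseteq> bracket_space L U"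
    and inv: "\<And>u c. \<lbrakk>u \<in> U; c \<in> C\<rbrakk> \<Longrightarrow> bracket u c \<in> C"
    and comm: "\<And>u u' c. \<lbrakk>u \<in> U; u' \<in> U; c \<in> C\<rbrakk> \<Longrightarrow> bracket (bracket u u') c = 0"
    and "u \<in> U" "c \<in> C"
  shows "bracket u c = 0"
proof -
  have subC: "subspace C" "C \<noteq> {0}" and modC: "lie_submodule L C"
    using C by (auto simp: simple_module_def lie_submodule_def)
  \<comment> \<open>A finite basis of \<open>U\<close> suffices, because the elements having a given
    vector as eigenvector form a subspace.\<close>
  obtain B where B: "B \<subseteq> U" "independent B" "U \<subseteq> span B"
    using maximal_independent_subset by blast
  have "finite B"
    using finite_dimensional independent_span_bound[OF _ B(2)] by auto
  moreover have "bracket u (bracket u' c) = bracket u' (bracket u c)"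
    if "u \<in> B" "u' \<in> B" "c \<in> C" for u u' c
    using that B(1) comm[of u u' c] by (auto simp: bracket_derivation[of u u' c])
  ultimately obtain e where e: "e \<in> C" "e \<noteq> 0" and "\<forall>u\<in>B. \<exists>a. bracket u e = scale a e"
    using ex_common_eigenvector[of B C] subC inv B(1) by blast
  then have "B \<subseteq> {u. \<exists>a. bracket u e = scale a e}" by blast
  moreover have "subspace {u. \<exists>a. bracket u e = scale a e}"
    unfolding subspace_def
  proof (intro conjI ballI allI)
    show "0 \<in> {u. \<exists>a. bracket u e = scale a e}" by (auto intro!: exI[of _ 0])
  qed (auto simp: bracket_add_left bracket_scale_left scale_left_distrib[symmetric])
  ultimately have "U \<subseteq> {u. \<exists>a. bracket u e = scale a e}"
    using B(3) span_minimal by blast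
  then have "\<forall>w\<in>U. \<exists>a. bracket w e = scale a e" by blast
  then obtain \<phi> where \<phi>: "\<And>w. w \<in> U \<Longrightarrow> bracket w e = scale (\<phi> w) e" by metis
  have "bracket_space L U \<subseteq> {u. bracket u e = 0}"
  proof (rule bracket_space_subset)
    show "subspace {u. bracket u e = 0}"
      by (auto simp: subspace_def bracket_add_left bracket_scale_left)
    show "bracket x w \<in> {u. bracket u e = 0}" if "x \<in> L" "w \<in> U" for x w
      using eigenvalue_of_bracket_zero[of U x e \<phi> w] \<phi> U(1) that e(2)
      unfolding lie_submodule_def by blast
  qed
  then have eK: "e \<in> {c \<in> C. \<forall>u\<in>U. bracket u c = 0}" (is "e \<in> ?K") using U(2) e(1) by blast
  have "lie_submodule L ?K"
    unfolding lie_submodule_def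
  proof (intro conjI ballI)
    show "subspace ?K"
      using subC(1) by (auto simp: subspace_def bracket_add_right bracket_scale_right)
    fix x k assume x: "x \<in> L" and k: "k \<in> ?K"
    have "bracket w (bracket x k) = 0" if "w \<in> U" for w
    proof -
      have "bracket x w \<in> U" using U(1) x that by (auto simp: lie_submodule_def)
      then show ?thesis using bracket_derivation[of x w k] k that by simp
    qed
    then show "bracket x k \<in> ?K" using x k modC by (auto simp: lie_submodule_def)
  qed
  moreover have "?K \<noteq> {0}" "?K \<subseteq> C" using eK e(2) by blast+
  ultimately have "?K = C" using C unfolding simple_module_def by blast
  then show ?thesis using assms(6,7) by blast
qed

section \<open>Perfectness and the complement of the derived algebra\<close>

text \<open>Expanding brackets of \<open>L + H\<close> shows that they lie in
  \<open>L + C + [L, U]\<close>, which perfectness makes the whole algebra. Uniqueness of components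
  in \<open>L + C + U\<close> then places each \<open>u\<close> in \<open>[L, U]\<close>.\<close>

lemma complement_in_bracket_space:
  assumes "perfect" "subalgebra L" "direct_sum UNIV L H" "direct_sum H C U"
    and C: "lie_submodule L C" and U: "lie_submodule L U" and HH: "bracket_space H H \<subseteq> C"
  shows "U \<subseteq> bracket_space L U"
proof
  fix u assume "u \<in> U"
  have sub: "subspace L" "subspace H" "subspace C" "subspace U" "subspace (bracket_space L U)"
    and H: "H = {c + u | c u. c \<in> C \<and> u \<in> U}" and CU: "C \<inter> U = {0}" and LH: "L \<inter> H = {0}"
    and LL: "\<And>x y. \<lbrakk>x \<in> L; y \<in> L\<rbrakk> \<Longrightarrow> bracket x y \<in> L"
    and LH_all: "UNIV = {l + h | l h. l \<in> L \<and> h \<in> H}"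
    using assms by (auto simp: direct_sum_def subalgebra_def subspace_bracket_space)
  have BU: "bracket_space L U \<subseteq> U"
    using U by (intro bracket_space_subset) (auto simp: lie_submodule_def)
  let ?Q = "{c + w | c w. c \<in> C \<and> w \<in> bracket_space L U}"
  let ?P = "{l + q | l q. l \<in> L \<and> q \<in> ?Q}"
  have Q: "subspace ?Q" using sub by (intro subspace_sums)
  have "?Q \<subseteq> H" unfolding H using BU by blast
  have P: "subspace ?P" by (rule subspace_sums[OF sub(1) Q])
  have LHQ: "bracket l h \<in> ?Q" if "l \<in> L" "h \<in> H" for l h
  proof -
    obtain c w where "h = c + w" "c \<in> C" "w \<in> U" using \<open>h \<in> H\<close> H by blast
    then show ?thesis using C \<open>l \<in> L\<close> bracket_in_bracket_space[of l L w U]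
      by (auto simp: bracket_add_right lie_submodule_def)
  qed
  have "bracket_space UNIV UNIV \<subseteq> ?P"
  proof (rule bracket_space_subset[OF P])
    fix a b :: 'a
    obtain l h where a: "a = l + h" "l \<in> L" "h \<in> H" using LH_all by blast
    obtain l' h' where b: "b = l' + h'" "l' \<in> L" "h' \<in> H" using LH_all by blast
    have "bracket h h' \<in> C" using HH bracket_in_bracket_space a b by blast
    then have "bracket h h' + 0 \<in> ?Q" using subspace_0[OF sub(5)] by blast
    then have "bracket h h' \<in> ?Q" by simp
    then have "bracket l h' - bracket l' h + bracket h h' \<in> ?Q"
      using a b LHQ by (intro subspace_add subspace_diff Q) auto
    moreover have "bracket a b = bracket l l' + (bracket l h' - bracket l' h + bracket h h')"
      unfolding a b bracket_add_left bracket_add_right bracket_antisym[of h l'] by simp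
    ultimately show "bracket a b \<in> ?P" using LL a b by blast
  qed
  then have "u \<in> ?P" using assms(1) unfolding perfect_def by blast
  then obtain l c w where l: "u = l + (c + w)" "l \<in> L" "c \<in> C" "w \<in> bracket_space L U" by blast
  have "w \<in> U" using l BU by blast
  have "c + w \<in> H" using l \<open>w \<in> U\<close> H by blast
  moreover have "0 + u \<in> H" unfolding H using subspace_0[OF sub(3)] \<open>u \<in> U\<close> by blast
  ultimately have "u - (c + w) \<in> H" using subspace_diff[OF sub(2)] by simp
  then have "l = 0" using l LH by auto
  then have "c = u - w" using l by simp
  then have "c \<in> U" using subspace_diff[OF sub(4) \<open>u \<in> U\<close> \<open>w \<in> U\<close>] by simp
  then have "c = 0" using l(3) CU by blast
  then show "u \<in> bracket_space L U" using l \<open>l = 0\<close> by simp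
qed

section \<open>The grading derivation\<close>

text \<open>The center of \<open>L\<close> is an ideal, and it is not \<open>L\<close> because
  \<open>[L, L]\<close> is nonzero.\<close>

lemma simple_lie_center_trivial:
  assumes "simple_lie L" "l \<in> L" "\<And>x. x \<in> L \<Longrightarrow> bracket l x = 0"
  shows "l = 0"
proof -
  let ?Z = "{z \<in> L. \<forall>x\<in>L. bracket z x = 0}"
  have L: "subspace L" using assms(1) by (simp add: simple_lie_def subalgebra_def)
  have "subspace ?Z"
    using L by (auto simp: subspace_def bracket_add_left bracket_scale_left)
  moreover have "bracket x z = 0" if "x \<in> L" "z \<in> ?Z" for x z
    using that bracket_antisym[of x z] by simp
  ultimately have "lie_ideal L ?Z"
    unfolding lie_ideal_def using L subspace_0[OF L] by auto
  then consider "?Z = {0}" | "?Z = L" using assms(1) unfolding simple_lie_def by blast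
  then show ?thesis
  proof cases
    case 1
    then show ?thesis using assms by blast
  next
    case 2
    then have "bracket_space L L \<subseteq> {0}"
      by (intro bracket_space_subset subspace_single_0) blast
    then show ?thesis
      using assms(1) subspace_0[OF subspace_bracket_space[of L L]] unfolding simple_lie_def by blast
  qed
qed

text \<open>Giving \<open>L\<close>, \<open>U\<close>, \<open>C\<close> the degrees 0, 1, 2 makes
  the bracket graded, and multiplication by the degree is an outer derivation. \<open>C\<close> may
  be zero, which covers an abelian radical.\<close>

lemma graded_not_sympathetic:
  assumes "simple_lie L" "direct_sum UNIV L H" "direct_sum H C U"
    and C: "lie_submodule L C" and U: "lie_submodule L U" "U \<noteq> {0}"
    and HH: "bracket_space H H \<subseteq> C" and HC: "\<And>h c. \<lbrakk>h \<in> H; c \<in> C\<rbrakk> \<Longrightarrow> bracket h c = 0"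
  shows "\<not> sympathetic"
proof
  assume symp: "sympathetic"
  have sub: "subspace L" "subspace H" "subspace C" "subspace U"
    and H: "H = {c + u | c u. c \<in> C \<and> u \<in> U}" and CU: "C \<inter> U = {0}" and LH: "L \<inter> H = {0}"
    and LL: "\<And>x y. \<lbrakk>x \<in> L; y \<in> L\<rbrakk> \<Longrightarrow> bracket x y \<in> L"
    and LC: "\<And>x y. \<lbrakk>x \<in> L; y \<in> C\<rbrakk> \<Longrightarrow> bracket x y \<in> C"
    and LU: "\<And>x y. \<lbrakk>x \<in> L; y \<in> U\<rbrakk> \<Longrightarrow> bracket x y \<in> U"
    and LH_all: "UNIV = {l + h | l h. l \<in> L \<and> h \<in> H}"
    using assms by (auto simp: direct_sum_def simple_lie_def subalgebra_def lie_submodule_def)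
  have CH: "C \<subseteq> H" unfolding H using subspace_0[OF sub(4)] by force
  have UH: "U \<subseteq> H" unfolding H using subspace_0[OF sub(3)] by force
  have UU: "bracket u u' \<in> C" if "u \<in> U" "u' \<in> U" for u u'
    using HH bracket_in_bracket_space[of u H u' H] that UH by blast
  have CL: "bracket c l \<in> C" if "c \<in> C" "l \<in> L" for c l
    using LC[OF that(2,1)] subspace_neg[OF sub(3)] bracket_antisym[of c l] by simp
  have UL: "bracket u l \<in> U" if "u \<in> U" "l \<in> L" for u l
    using LU[OF that(2,1)] subspace_neg[OF sub(4)] bracket_antisym[of u l] by simp
  have CH0: "bracket c h = 0" if "h \<in> H" "c \<in> C" for h c
    using HC[OF that] bracket_antisym[of c h] by simp
  have "\<exists>l c u. l \<in> L \<and> c \<in> C \<and> u \<in> U \<and> y = l + c + u" for y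
  proof -
    have "y \<in> {l + h | l h. l \<in> L \<and> h \<in> H}" using LH_all by blast
    then obtain l h where "y = l + h" "l \<in> L" "h \<in> H" by blast
    then show ?thesis unfolding H by (auto simp: add.assoc)
  qed
  \<comment> \<open>Component functions obtained by choice; their additivity and homogeneity on
    \<open>C\<close> and \<open>U\<close> come from \<open>uniq\<close>.\<close>
  then obtain pl pc pu where p: "\<And>y. pl y \<in> L" "\<And>y. pc y \<in> C" "\<And>y. pu y \<in> U"
    "\<And>y. y = pl y + pc y + pu y"
    by metis
  have uniq: "c = c' \<and> u = u'"
    if "l \<in> L" "c \<in> C" "u \<in> U" "l' \<in> L" "c' \<in> C" "u' \<in> U" "l + c + u = l' + c' + u'"
    for l c u l' c' u'
  proof -
    have eq: "l - l' = (c' - c) + (u' - u)" using that(7) by (simp add: algebra_simps)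
    moreover have "(c' - c) + (u' - u) \<in> H"
      using that CH UH by (intro subspace_add subspace_diff sub) auto
    moreover have "l - l' \<in> L" using that sub by (auto intro: subspace_diff)
    ultimately have "(c' - c) + (u' - u) = 0" using LH by auto
    then have cu: "c - c' = u' - u" by (simp add: algebra_simps)
    moreover have "c - c' \<in> C" "u' - u \<in> U" using that sub by (auto intro: subspace_diff)
    ultimately have "c - c' = 0" using CU by (metis IntI singletonD)
    then show ?thesis using cu by simp
  qed
  define D where "D y = scale 2 (pc y) + pu y" for y
  have D: "D (l + c + u) = scale 2 c + u" if "l \<in> L" "c \<in> C" "u \<in> U" for l c u
    using uniq[OF that p(1-3)[of "l + c + u"] p(4)] by (auto simp: D_def)
  have two: "scale 2 y = y + y" for y
    using scale_left_distrib[of 1 1 y] by simp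
  have "D (x + y) = D x + D y" for x y
  proof -
    have "x + y = (pl x + pl y) + (pc x + pc y) + (pu x + pu y)"
      using p(4)[of x] p(4)[of y] by (metis add.assoc add.left_commute)
    then have "D (x + y) = scale 2 (pc x + pc y) + (pu x + pu y)"
      using D[of "pl x + pl y" "pc x + pc y" "pu x + pu y"] p sub by (simp add: subspace_add)
    then show ?thesis by (simp add: D_def scale_right_distrib algebra_simps)
  qed
  moreover have "D (scale r x) = scale r (D x)" for r x
  proof -
    have "scale r x = scale r (pl x) + scale r (pc x) + scale r (pu x)"
      using p(4)[of x] by (metis scale_right_distrib)
    then have "D (scale r x) = scale 2 (scale r (pc x)) + scale r (pu x)"
      using D[of "scale r (pl x)" "scale r (pc x)" "scale r (pu x)"] p sub
      by (simp add: subspace_scale)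
    then show ?thesis by (simp add: D_def scale_right_distrib scale_left_commute)
  qed
  ultimately have "Vector_Spaces.linear scale scale D" by unfold_locales auto
  moreover have "D (bracket x y) = bracket (D x) y + bracket x (D y)" for x y
  proof -
    define l c u where "l = pl x" "c = pc x" "u = pu x"
    define l' c' u' where "l' = pl y" "c' = pc y" "u' = pu y"
    note defs = \<open>l = pl x\<close> \<open>c = pc x\<close> \<open>u = pu x\<close> \<open>l' = pl y\<close> \<open>c' = pc y\<close> \<open>u' = pu y\<close>
    have m: "l \<in> L" "c \<in> C" "u \<in> U" "l' \<in> L" "c' \<in> C" "u' \<in> U" by (simp_all add: defs p)
    then have mH: "c \<in> H" "u \<in> H" "c' \<in> H" "u' \<in> H" using CH UH by auto
    note zero = HC[OF mH(2) m(5)] HC[OF mH(1) m(5)] CH0[OF mH(4) m(2)]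
    have x: "x = l + c + u" and y: "y = l' + c' + u'" unfolding defs by (rule p(4))+
    \<comment> \<open>Of the nine brackets, those of \<open>C\<close> with \<open>H\<close> vanish;
      the rest are grouped by degree.\<close>
    have "bracket x y = bracket l l' + (bracket l c' + bracket c l' + bracket u u')
        + (bracket l u' + bracket u l')"
      unfolding x y bracket_add_left bracket_add_right zero by (simp add: algebra_simps)
    then have "D (bracket x y) = scale 2 (bracket l c' + bracket c l' + bracket u u')
        + (bracket l u' + bracket u l')"
      using m by (simp add: D subspace_add sub LL LC LU CL UL UU)
    \<comment> \<open>The doubled \<open>bracket u u'\<close> in degree 2 is matched by one copy
      from \<open>D x\<close> and one from \<open>D y\<close>.\<close>
    moreover have "D x = c + c + u" "D y = c' + c' + u'" using m by (auto simp: x y D two)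
    ultimately show ?thesis
      unfolding two by (simp add: x y bracket_add_left bracket_add_right zero algebra_simps)
  qed
  ultimately have "D \<in> range ad" using symp unfolding sympathetic_def Der_def by blast
  then obtain g where g: "D y = bracket g y" for y unfolding ad_def by auto
  have "g \<in> {l + h | l h. l \<in> L \<and> h \<in> H}" using LH_all by blast
  then obtain l h where lh: "g = l + h" "l \<in> L" "h \<in> H" by blast
  \<comment> \<open>Since \<open>D\<close> kills \<open>x\<close>, the bracket
    \<open>bracket l x\<close> in \<open>L\<close> equals \<open>bracket x h\<close> in
    \<open>H\<close>.\<close>
  have "bracket l x = 0" if "x \<in> L" for x
  proof -
    have "D x = 0" using D[OF that subspace_0[OF sub(3)] subspace_0[OF sub(4)]] by simp
    then have "bracket l x = bracket x h"
      using g[of x] unfolding lh bracket_add_left bracket_antisym[of h x] by simp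
    moreover have "bracket x h \<in> H"
      using lh(3) H LC[OF that] LU[OF that] by (auto simp: bracket_add_right) blast
    ultimately show ?thesis using LL[OF lh(2) that] LH by auto
  qed
  then have "l = 0" using simple_lie_center_trivial[OF assms(1) lh(2)] by blast
  \<comment> \<open>\<open>D\<close> fixes \<open>u\<close>, yet \<open>bracket h u\<close> lies in
    \<open>C\<close>, which meets \<open>U\<close> only in 0.\<close>
  have "u = 0" if "u \<in> U" for u
  proof -
    have "u = bracket h u"
      using D[OF subspace_0[OF sub(1)] subspace_0[OF sub(3)] that] g[of u] lh \<open>l = 0\<close> by simp
    moreover have "bracket h u \<in> C"
      using HH bracket_in_bracket_space[of h H u H] lh(3) that UH by blast
    ultimately show ?thesis using that CU by auto
  qed
  then show False using U(2) subspace_0[OF sub(4)] by blast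
qed

text \<open>With \<open>C = {0}\<close> and \<open>U = H\<close> the derivation is the projection
  onto \<open>H\<close> along \<open>L\<close>.\<close>

lemma abelian_radical_not_sympathetic:
  assumes "simple_lie L" "direct_sum UNIV L H" "lie_submodule L H" "H \<noteq> {0}"
    and "bracket_space H H = {0}"
  shows "\<not> sympathetic"
proof (rule graded_not_sympathetic[of L H "{0}" H])
  show "direct_sum H {0} H"
    using assms(3) subspace_0 by (auto simp: direct_sum_def lie_submodule_def subspace_single_0)
  show "lie_submodule L {0}" by (simp add: lie_submodule_def subspace_single_0)
qed (use assms in auto)

section \<open>Case distinction on the derived algebra of the radical\<close>

theorem radical_length_le_two_not_sympathetic:
  assumes "perfect" "levi_decomposition L H" "simple_lie L"
    and len: "simple_module L H \<or>
      (\<exists>V W. simple_module L V \<and> simple_module L W \<and> direct_sum H V W)"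
  shows "\<not> sympathetic"
proof -
  have LH: "direct_sum UNIV L H" and sol: "solvable H" and H: "lie_submodule L H"
    using assms(2) by (auto simp: levi_decomposition_def is_radical_def lie_ideal_def lie_submodule_def)
  have idealH: "\<And>x h. h \<in> H \<Longrightarrow> bracket x h \<in> H"
    using assms(2) by (auto simp: levi_decomposition_def is_radical_def lie_ideal_def)
  have subH: "subspace H" using H by (simp add: lie_submodule_def)
  define C where "C = bracket_space H H"
  have C: "lie_submodule L C" unfolding C_def using H H by (rule lie_submodule_bracket_space)
  have CH: "C \<subseteq> H" unfolding C_def using subH idealH by (intro bracket_space_subset)
  show ?thesis
  proof (cases "H = {0} \<or> C = {0}")
    case True
    \<comment> \<open>Simple modules are nonzero, so this case reduces to an abelian
      radical.\<close>
    have "H \<noteq> {0}"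
      using len
    proof
      assume "\<exists>V W. simple_module L V \<and> simple_module L W \<and> direct_sum H V W"
      then obtain V W where V: "V \<noteq> {0}" "subspace V" "subspace W"
        and VW: "H = {v + w | v w. v \<in> V \<and> w \<in> W}"
        by (auto simp: simple_module_def direct_sum_def)
      have "V \<subseteq> H" unfolding VW using subspace_0[OF V(3)] by force
      then show "H \<noteq> {0}" using V(1) subspace_0[OF V(2)] by blast
    qed (simp add: simple_module_def)
    then show ?thesis using True abelian_radical_not_sympathetic[OF assms(3) LH H] C_def by blast
  next
    case False
    have "C \<noteq> H" using solvable_perfect_subset_trivial[OF sol, of H] False C_def by blast
    \<comment> \<open>\<open>C\<close> is a nonzero proper submodule, so only the case of two
      summands remains.\<close>
    then have "\<not> simple_module L H" using C CH False unfolding simple_module_def by blast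
    then obtain U where C': "simple_module L C" and U: "simple_module L U" "direct_sum H C U"
      using len proper_submodule_simple_with_complement[OF _ _ _ C CH] False \<open>C \<noteq> H\<close> by blast
    have U': "lie_submodule L U" "U \<noteq> {0}" using U by (auto simp: simple_module_def)
    have subC: "subspace C" using C by (simp add: lie_submodule_def)
    have HHC: "bracket h h' \<in> C" if "h \<in> H" "h' \<in> H" for h h'
      unfolding C_def using that by (rule bracket_in_bracket_space)
    \<comment> \<open>Solvability excludes \<open>[C, C] = C\<close>, so simplicity of
      \<open>C\<close> forces \<open>C\<close> to be abelian.\<close>
    have "bracket_space C C \<noteq> C"
      using solvable_perfect_subset_trivial[OF sol CH] False by blast
    moreover have "bracket_space C C \<subseteq> C"
      using subC HHC CH by (intro bracket_space_subset) auto
    ultimately have "bracket_space C C = {0}"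
      using C' lie_submodule_bracket_space[OF C C] unfolding simple_module_def by blast
    then have CC: "bracket c c' = 0" if "c \<in> C" "c' \<in> C" for c c'
      using bracket_in_bracket_space[OF that] by simp
    have HU: "H = {c + u | c u. c \<in> C \<and> u \<in> U}" using U(2) by (simp add: direct_sum_def)
    have UH: "U \<subseteq> H" unfolding HU using subspace_0[OF subC] by force
    have "subalgebra L" using assms(3) by (simp add: simple_lie_def)
    then have "U \<subseteq> bracket_space L U"
      using complement_in_bracket_space[OF assms(1) _ LH U(2) C U'(1)] C_def by blast
    then have UC: "bracket u c = 0" if "u \<in> U" "c \<in> C" for u c
      using commuting_module_acts_trivially[OF C' U'(1), of u c] that HHC CC UH CH by blast
    show ?thesis
    proof (rule graded_not_sympathetic[OF assms(3) LH U(2) C U'])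
      show "bracket_space H H \<subseteq> C" by (simp add: C_def)
      show "bracket h c = 0" if "h \<in> H" "c \<in> C" for h c
        using that CC UC unfolding HU by (auto simp: bracket_add_left)
    qed
  qed
qed

end

theorem corollary3p10:
  fixes scale :: "complex \<Rightarrow> 'a::ab_group_add \<Rightarrow> 'a"
    and bracket :: "'a \<Rightarrow> 'a \<Rightarrow> 'a"
    and L H :: "'a set"
  assumes "lie_algebra scale bracket"
    and "lie_algebra.perfect scale bracket"
    and "lie_algebra.levi_decomposition scale bracket L H"
    and "lie_algebra.simple_lie scale bracket L"
    and "lie_algebra.simple_module scale bracket L H \<or>
         (\<exists>V W. lie_algebra.simple_module scale bracket L V \<and>
                lie_algebra.simple_module scale bracket L W \<and>
                lie_algebra.direct_sum scale H V W)"
  shows "\<not> lie_algebra.sympathetic scale bracket"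
  using lie_algebra.radical_length_le_two_not_sympathetic[OF assms] .

end
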